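(* Let $r=[a_1,a_2,\dots,a_m]$ be a continued fraction expansion of a rational number $r$, and let $\boldsymbol{a}=(a_1,a_2,\dots,a_m)$. Then a rational number $\tilde r$ belongs to the $\hat\Gamma_r$-orbit of $r$ or of $\infty$ if and only if $\tilde r$ has a continued fraction expansion $$\tilde r=2c+[\epsilon_1\boldsymbol{a},2c_1,\epsilon_2\boldsymbol{a}^{-1},2c_2,\epsilon_3\boldsymbol{a},\dots,2c_{n-1},\epsilon_n\boldsymbol{a}^{(-1)^{n-1}}]$$ for some positive integer $n$, some $c\in\mathbb{Z}$, some $(\epsilon_1,\epsilon_2,\dots,\epsilon_n)\in\{-,+\}^n$ and some $(c_1,c_2,\dots,c_{n-1})\in\mathbb{Z}^{n-1}$.
   Context: Continued fractions: $[a_1,a_2,\dots,a_m]=\cfrac{1}{a_1+\cfrac{1}{a_2+\cdots+\cfrac{1}{a_m}}}$ with integer entries, evaluated in $\hat{\mathbb{Q}}=\mathbb{Q}\cup\{\infty\}$ (with $1/0=\infty$, $1/\infty=0$, $a+\infty=\infty$; entries may be zero or negative). For a finite sequence $\boldsymbol{a}=(a_1,\dots,a_m)$ and $\epsilon\in\{-,+\}$: $\epsilon\boldsymbol{a}=(\epsilon a_1,\dots,\epsilon a_m)$, $\boldsymbol{a}^{-1}=(a_m,a_{m-1},\dots,a_1)$ is the reversed sequence, $\epsilon\boldsymbol{a}^{-1}=(\epsilon a_m,\dots,\epsilon a_1)$, and $\boldsymbol{a}^{+1}=\boldsymbol{a}$. In the displayed formula the sequences are concatenated. Groups: Let $\mathcal{D}$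 be the modular tessellation (Farey tessellation) of the hyperbolic plane $\mathbb{H}^2$ (upper half plane), i.e. the tessellation by ideal triangles obtained from the ideal triangle with vertices $0,1,\infty$ by repeated reflection in the edges; its set of ideal vertices is $\hat{\mathbb{Q}}$. For $r\in\hat{\mathbb{Q}}$, $\Gamma_r$ is the group of automorphisms of $\mathcal{D}$ generated by the reflections in the edges of $\mathcal{D}$ having $r$ as an endpoint, and $\hat\Gamma_r$ is the group generated by $\Gamma_r$ and $\Gamma_\infty$. These groups act on $\hat{\mathbb{Q}}$. *)

theory Defs
  imports Complex_Main "HOL-Algebra.Algebra"
begin

text \<open>One-point extension: \<open>rat\<close> gives the extended rationals, \<open>complex\<close> the Riemann sphere.\<close>

datatype 'a proj_line = Fin 'a | Infty

definition proj_inverse :: "rat proj_line \<Rightarrow> rat proj_line" where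
  "proj_inverse x = (case x of Fin q \<Rightarrow> (if q = 0 then Infty else Fin (1 / q)) | Infty \<Rightarrow> Fin 0)"

definition proj_add_int :: "int \<Rightarrow> rat proj_line \<Rightarrow> rat proj_line" where
  "proj_add_int k x = map_proj_line (\<lambda>q. of_int k + q) x"

text \<open>The value of the empty list is a convention that makes the recursion start with
  \<open>[a\<^sub>m] = 1 / (a\<^sub>m + 0)\<close>.\<close>

fun cfrac :: "int list \<Rightarrow> rat proj_line" where
  "cfrac [] = Fin 0"
| "cfrac (a # as) = proj_inverse (proj_add_int a (cfrac as))"

text \<open>The sequence \<open>\<epsilon>\<^sub>1 a, 2 c\<^sub>1, \<epsilon>\<^sub>2 a\<^sup>-\<^sup>1, 2 c\<^sub>2, \<dots>, 2 c\<^sub>n\<^sub>-\<^sub>1, \<epsilon>\<^sub>n a\<^sup>\<plusminus>\<^sup>1\<close> for \<open>n \<ge> 1\<close>;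
  indices of \<open>\<epsilon>\<close> and \<open>c\<close> start at 1, and a sign is encoded as the integer 1 or -1.\<close>

definition signed_block :: "int list \<Rightarrow> (nat \<Rightarrow> int) \<Rightarrow> nat \<Rightarrow> int list" where
  "signed_block a \<epsilon> i = map (\<lambda>x. \<epsilon> i * x) (if odd i then a else rev a)"

definition expansion_seq :: "int list \<Rightarrow> nat \<Rightarrow> (nat \<Rightarrow> int) \<Rightarrow> (nat \<Rightarrow> int) \<Rightarrow> int list" where
  "expansion_seq a n \<epsilon> c =
     signed_block a \<epsilon> 1 @ concat (map (\<lambda>i. 2 * c i # signed_block a \<epsilon> (i + 1)) [1..<n])"

text \<open>The upper half plane model together with its circle at infinity, inside the Riemann sphere.
  Isometries are considered with their continuous extension to the ideal boundary.\<close>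

definition H2_boundary :: "complex proj_line set" where
  "H2_boundary = insert Infty {Fin z | z. Im z = 0}"

definition H2_closed :: "complex proj_line set" where
  "H2_closed = insert Infty {Fin z | z. Im z \<ge> 0}"

definition ideal_point :: "rat proj_line \<Rightarrow> complex proj_line" where
  "ideal_point = map_proj_line of_rat"

text \<open>\<open>reflection p q\<close> is the reflection in the geodesic with distinct ideal endpoints
  \<open>p\<close> and \<open>q\<close>: reflection in a vertical line if an endpoint is \<open>\<infinity>\<close>, and otherwise inversion
  in the circle with centre \<open>(x + y) / 2\<close> and radius \<open>\<bar>x - y\<bar> / 2\<close>.
  It is only meaningful for distinct \<open>p\<close>, \<open>q\<close> in \<open>H2_boundary\<close>.\<close>

definition vertical_reflection :: "complex \<Rightarrow> complex proj_line \<Rightarrow> complex proj_line" where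
  "vertical_reflection x = map_proj_line (\<lambda>z. 2 * x - cnj z)"

definition circle_inversion ::
    "complex \<Rightarrow> complex \<Rightarrow> complex proj_line \<Rightarrow> complex proj_line" where
  "circle_inversion x y w =
     (let m = (x + y) / 2 in
      case w of
        Infty \<Rightarrow> Fin m
      | Fin z \<Rightarrow> (if z = m then Infty else Fin (m + ((x - y) / 2)\<^sup>2 / (cnj z - m))))"

fun reflection :: "complex proj_line \<Rightarrow> complex proj_line \<Rightarrow> complex proj_line \<Rightarrow> complex proj_line"
  where
  "reflection (Fin x) (Fin y) = circle_inversion x y"
| "reflection Infty (Fin y) = vertical_reflection y"
| "reflection (Fin x) Infty = vertical_reflection x"
| "reflection Infty Infty = id"

text \<open>Triangles are closed regions containing their three ideal vertices, so the vertices of \<open>T\<close>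
  are the points of \<open>T \<inter> H2_boundary\<close>.\<close>

definition base_triangle :: "complex proj_line set" where
  "base_triangle =
     insert Infty {Fin z | z. Im z \<ge> 0 \<and> 0 \<le> Re z \<and> Re z \<le> 1 \<and> cmod (z - 1 / 2) \<ge> 1 / 2}"

lemma base_triangle_vertices:
  "base_triangle \<inter> H2_boundary = {Fin 0, Fin 1, Infty}"
proof -
  have "z = 0 \<or> z = 1"
    if "Im z = 0" "0 \<le> Re z" "Re z \<le> 1" "cmod (z - 1 / 2) \<ge> 1 / 2" for z
  proof -
    have "z - 1 / 2 = complex_of_real (Re z - 1 / 2)"
      using that(1) by (simp add: complex_eq_iff)
    then have "\<bar>Re z - 1 / 2\<bar> \<ge> 1 / 2"
      using that(4) by (metis norm_of_real)
    with that(2,3) have "Re z = 0 \<or> Re z = 1" by linarith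
    with that(1) show ?thesis by (auto simp: complex_eq_iff)
  qed
  then show ?thesis
    by (auto simp: base_triangle_def H2_boundary_def norm_divide)
qed

inductive_set modular_tessellation :: "complex proj_line set set" where
  base: "base_triangle \<in> modular_tessellation"
| reflect: "\<lbrakk>T \<in> modular_tessellation; p \<in> T \<inter> H2_boundary; q \<in> T \<inter> H2_boundary; p \<noteq> q\<rbrakk>
    \<Longrightarrow> reflection p q ` T \<in> modular_tessellation"

text \<open>\<open>tess_edge p q\<close>: the geodesic with ideal endpoints \<open>p\<close> and \<open>q\<close> is an edge of the tessellation.\<close>

definition tess_edge :: "complex proj_line \<Rightarrow> complex proj_line \<Rightarrow> bool" where
  "tess_edge p q \<longleftrightarrow>
     p \<noteq> q \<and> (\<exists>T \<in> modular_tessellation. p \<in> T \<inter> H2_boundary \<and> q \<in> T \<inter> H2_boundary)"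

definition Gamma ::
    "rat proj_line \<Rightarrow> (complex proj_line \<Rightarrow> complex proj_line) monoid" where
  "Gamma r = subgroup_generated (BijGroup H2_closed)
     {restrict (reflection (ideal_point r) q) H2_closed | q. tess_edge (ideal_point r) q}"

definition Gamma_hat ::
    "rat proj_line \<Rightarrow> (complex proj_line \<Rightarrow> complex proj_line) monoid" where
  "Gamma_hat r = subgroup_generated (BijGroup H2_closed)
     (carrier (Gamma r) \<union> carrier (Gamma Infty))"

definition Gamma_hat_orbit :: "rat proj_line \<Rightarrow> rat proj_line \<Rightarrow> complex proj_line set" where
  "Gamma_hat_orbit r x = orbit (Gamma_hat r) (\<lambda>g. g) (ideal_point x)"

text \<open>Since \<open>subgroup_generated\<close> intersects the generators with the carrier of the ambient group,
  the following lemmas confirm that no generator is lost.\<close>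

lemma reflection_involution:
  assumes "p \<in> H2_boundary" "q \<in> H2_boundary" "p \<noteq> q"
  shows "reflection p q (reflection p q w) = w"
proof (cases p)
  case p: (Fin x)
  show ?thesis
  proof (cases q)
    case q: (Fin y)
    have *: "cnj x = x" "cnj y = y" "x \<noteq> y"
      using assms p q by (auto simp: H2_boundary_def complex_eq_iff)
    define m where "m = (x + y) / 2"
    define s where "s = ((x - y) / 2)\<^sup>2"
    have ms: "cnj m = m" "cnj s = s" "s \<noteq> 0"
      using * by (simp_all add: m_def s_def)
    have ci: "circle_inversion x y v =
        (case v of Infty \<Rightarrow> Fin m | Fin z \<Rightarrow> if z = m then Infty else Fin (m + s / (cnj z - m)))" for v
      unfolding circle_inversion_def Let_def m_def s_def ..
    have "cnj z \<noteq> m" if "z \<noteq> m" for z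
      using that ms(1) by (metis complex_cnj_cnj)
    then show ?thesis
      using ms by (cases w) (simp_all add: p q ci)
  qed (use assms p in \<open>cases w; auto simp: vertical_reflection_def H2_boundary_def complex_eq_iff\<close>)
next
  case p: Infty
  then show ?thesis
    using assms
    by (cases q; cases w) (auto simp: vertical_reflection_def H2_boundary_def complex_eq_iff)
qed

lemma reflection_closed:
  assumes "p \<in> H2_boundary" "q \<in> H2_boundary" "w \<in> H2_closed"
  shows "reflection p q w \<in> H2_closed"
proof (cases p)
  case p: (Fin x)
  show ?thesis
  proof (cases q)
    case q: (Fin y)
    have *: "Im x = 0" "Im y = 0" using assms p q by (auto simp: H2_boundary_def)
    define m where "m = (x + y) / 2"
    define s where "s = ((x - y) / 2)\<^sup>2"
    have ms: "Im m = 0" "Im s = 0" "Re s \<ge> 0"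
      using * by (simp_all add: m_def s_def power2_eq_square)
    have ci: "circle_inversion x y v =
        (case v of Infty \<Rightarrow> Fin m | Fin z \<Rightarrow> if z = m then Infty else Fin (m + s / (cnj z - m)))" for v
      unfolding circle_inversion_def Let_def m_def s_def ..
    have "Im (s / (cnj z - m)) \<ge> 0" if "Im z \<ge> 0" for z
      using ms that by (simp add: Im_divide)
    then show ?thesis
      using ms assms(3) by (cases w) (simp_all add: p q ci H2_closed_def)
  qed (use assms p in \<open>auto simp: vertical_reflection_def H2_boundary_def H2_closed_def\<close>)
next
  case p: Infty
  then show ?thesis
    using assms by (cases q) (auto simp: vertical_reflection_def H2_boundary_def H2_closed_def)
qed

lemma reflection_in_BijGroup:
  assumes "p \<in> H2_boundary" "q \<in> H2_boundary" "p \<noteq> q"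
  shows "restrict (reflection p q) H2_closed \<in> carrier (BijGroup H2_closed)"
proof -
  have "bij_betw (reflection p q) H2_closed H2_closed"
    by (rule bij_betw_byWitness[where f' = "reflection p q"])
      (use reflection_involution[OF assms] reflection_closed[OF assms(1,2)] in auto)
  then show ?thesis by (simp add: BijGroup_def Bij_def)
qed

end

theory Submission
  imports Defs
begin

text \<open>Let \<open>J\<close> be the inversion in the unit circle, \<open>A\<^sup>b\<close> the translation by \<open>b\<close> and \<open>N\<close> the reflection
  in the imaginary axis. On real points \<open>J\<close> is \<open>x \<mapsto> 1 / x\<close>, so the continued fraction of
  \<open>a = (a\<^sub>1, \<dots>, a\<^sub>m)\<close> is the image of \<open>\<infinity>\<close> under
  \<open>W\<^sub>a = J A\<^bsup>a\<^sub>1\<^esup> J \<dots> A\<^bsup>a\<^sub>m\<^esup> J\<close> (\<open>ideal_point_cfrac\<close>). Concatenation, change of sign and reversal of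
  sequences become operations on these isometries: a middle entry \<open>b\<close> contributes
  \<open>W\<^sub>x A\<^sup>b W\<^sub>y\<close>, the sequence \<open>- a\<close> gives \<open>N W\<^sub>a N\<close>, and the reversed sequence gives
  \<open>N W\<^sub>a\<^sup>-\<^sup>1 N\<close>.

  The edges at \<open>\<infinity>\<close> are the vertical lines over the integers, so \<open>\<Gamma>\<^sub>\<infinity>\<close> consists of the maps
  \<open>A\<^bsup>2k\<^esup>\<close> and \<open>A\<^bsup>2k\<^esup> N\<close>. As \<open>J\<close> and the \<open>A\<^sup>b\<close> preserve the tessellation, so does \<open>W = W\<^sub>a\<close>, and it
  carries \<open>\<infinity>\<close> to \<open>r\<close>; hence \<open>\<Gamma>\<^sub>r\<close> is the conjugate of \<open>\<Gamma>\<^sub>\<infinity>\<close> by \<open>W\<close>. The points in the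
  orbits of \<open>r = W \<infinity>\<close> and of \<open>\<infinity>\<close> are therefore the points
  \<open>d\<^sub>0 W d\<^sub>1 W\<^sup>-\<^sup>1 d\<^sub>2 W \<dots> W\<^bsup>\<plusminus>1\<^esup> \<infinity>\<close> with \<open>d\<^sub>i \<in> \<Gamma>\<^sub>\<infinity>\<close>. The translation parts of the \<open>d\<^sub>i\<close> are the
  entries \<open>2c, 2c\<^sub>1, 2c\<^sub>2, \<dots>\<close> of the expansion, and their parts \<open>N\<close> are absorbed by the signs of
  the blocks.

  The formal argument avoids normal forms of group elements and compares sets of points. The set
  \<open>V a\<close> of values of the expansions built from \<open>a\<close> (\<open>expansion_values\<close>) is closed under \<open>\<Gamma>\<^sub>\<infinity>\<close>, contains \<open>\<infinity>\<close>, and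
  satisfies \<open>W (V (rev a)) \<subseteq> V a\<close> and \<open>W\<^sup>-\<^sup>1 (V a) \<subseteq> V (rev a)\<close>. So it is closed under \<open>\<Gamma>\<^sub>r\<close> as
  well and contains both orbits. Conversely, \<open>expansion_values_subset\<close> shows that \<open>V a\<close> lies in
  every set with the closure properties of the union of the two orbits.\<close>

section \<open>Reflections in homogeneous coordinates\<close>

text \<open>Homogeneous coordinates remove the case distinctions on \<open>\<infinity>\<close>: inversions in circles and
  reflections in vertical lines are given by one formula, and compatibility with the symmetries of
  the tessellation becomes an identity between polynomials.\<close>

definition hom_pt :: "complex \<Rightarrow> complex \<Rightarrow> complex proj_line" where
  "hom_pt u v = (if v = 0 then Infty else Fin (u / v))"

lemma hom_pt_scale: "c \<noteq> 0 \<Longrightarrow> hom_pt (c * u) (c * v) = hom_pt u v"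
  by (simp add: hom_pt_def)

lemma hom_pt_uminus: "hom_pt (- u) (- v) = hom_pt u v"
  by (simp add: hom_pt_def)

lemma hom_pt_cases:
  obtains u v where "w = hom_pt u v" "u \<noteq> 0 \<or> v \<noteq> 0"
proof (cases w)
  case (Fin z)
  then show ?thesis using that[of z 1] by (simp add: hom_pt_def)
next
  case Infty
  then show ?thesis using that[of 1 0] by (simp add: hom_pt_def)
qed

lemma hom_pt_real_in_boundary: "hom_pt (of_real u) (of_real v) \<in> H2_boundary"
  by (auto simp: hom_pt_def H2_boundary_def)

lemma H2_boundary_cases:
  assumes "p \<in> H2_boundary"
  obtains u v :: real where "p = hom_pt (of_real u) (of_real v)" "u \<noteq> 0 \<or> v \<noteq> 0"
proof (cases p)
  case (Fin z)
  then have "z = of_real (Re z)" using assms by (auto simp: H2_boundary_def complex_eq_iff)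
  then show ?thesis using that[of "Re z" 1] Fin by (simp add: hom_pt_def)
next
  case Infty
  then show ?thesis using that[of 1 0] by (simp add: hom_pt_def)
qed

lemma hom_pt_distinct_imp_det_nonzero:
  fixes x1 x2 y1 y2 :: real
  assumes "hom_pt (of_real x1) (of_real x2) \<noteq> hom_pt (of_real y1) (of_real y2)"
    and "x1 \<noteq> 0 \<or> x2 \<noteq> 0" "y1 \<noteq> 0 \<or> y2 \<noteq> 0"
  shows "x1 * y2 \<noteq> y1 * x2"
proof
  assume eq: "x1 * y2 = y1 * x2"
  then have "x2 = 0 \<longleftrightarrow> y2 = 0" using assms(2,3) by auto
  moreover have "x1 / x2 = y1 / y2" if "x2 \<noteq> 0" "y2 \<noteq> 0"
    using eq that by (simp add: field_simps)
  ultimately show False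
    using assms(1) by (auto simp: hom_pt_def simp flip: of_real_divide)
qed

text \<open>With \<open>m = (x + y) / 2\<close> the inversion in the circle over \<open>x, y\<close> is
  \<open>z \<mapsto> (m cnj z - x y) / (cnj z - m)\<close>, because \<open>m\<^sup>2 - ((x - y) / 2)\<^sup>2 = x y\<close>. Clearing
  denominators gives this antiholomorphic map with a real matrix of determinant
  \<open>- (x\<^sub>1 y\<^sub>2 - y\<^sub>1 x\<^sub>2)\<^sup>2\<close>, which remains correct if one of \<open>x, y\<close> is \<open>\<infinity>\<close>.\<close>

lemma reflection_hom_pt:
  fixes x1 x2 y1 y2 :: real
  assumes det: "x1 * y2 \<noteq> y1 * x2" and z: "z1 \<noteq> 0 \<or> z2 \<noteq> 0"
  shows "reflection (hom_pt (of_real x1) (of_real x2)) (hom_pt (of_real y1) (of_real y2)) (hom_pt z1 z2)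
    = hom_pt (of_real (x1 * y2 + y1 * x2) * cnj z1 - of_real (2 * x1 * y1) * cnj z2)
             (of_real (2 * x2 * y2) * cnj z1 - of_real (x1 * y2 + y1 * x2) * cnj z2)"
proof -
  consider "x2 = 0" "y2 \<noteq> 0" "x1 \<noteq> 0" | "x2 \<noteq> 0" "y2 = 0" "y1 \<noteq> 0" | "x2 \<noteq> 0" "y2 \<noteq> 0"
    using det by (cases "x2 = 0"; cases "y2 = 0") auto
  then show ?thesis
  proof cases
    case 1
    then show ?thesis by (auto simp: hom_pt_def vertical_reflection_def field_simps)
  next
    case 2
    then show ?thesis by (auto simp: hom_pt_def vertical_reflection_def field_simps)
  next
    case 3
    define X1 X2 Y1 Y2 :: complex
      where X: "X1 = of_real x1" "X2 = of_real x2" "Y1 = of_real y1" "Y2 = of_real y2"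
    define M K P where "M = X1 * Y2 + Y1 * X2" and "K = 2 * X2 * Y2" and "P = X1 * Y1"
    note defs = M_def K_def P_def
    have nz: "X2 \<noteq> 0" "Y2 \<noteq> 0" "K \<noteq> 0" using 3 X by (auto simp: K_def)
    have cnj_id: "cnj M = M" "cnj K = K" by (simp_all add: defs X)
    have m: "(X1 / X2 + Y1 / Y2) / 2 = M / K"
      using nz by (simp add: defs field_simps)
    have s: "((X1 / X2 - Y1 / Y2) / 2)\<^sup>2 = (M\<^sup>2 - 2 * K * P) / K\<^sup>2"
      using nz by (simp add: defs field_simps power2_eq_square)
    have inversion: "circle_inversion (X1 / X2) (Y1 / Y2) w = (case w of
        Infty \<Rightarrow> Fin (M / K)
      | Fin z \<Rightarrow> if z = M / K then Infty else Fin (M / K + (M\<^sup>2 - 2 * K * P) / K\<^sup>2 / (cnj z - M / K)))"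
      for w
      unfolding circle_inversion_def Let_def m s ..
    have lhs: "reflection (hom_pt X1 X2) (hom_pt Y1 Y2) = circle_inversion (X1 / X2) (Y1 / Y2)"
      using nz by (simp add: hom_pt_def)
    have "circle_inversion (X1 / X2) (Y1 / Y2) (hom_pt z1 z2) =
      hom_pt (M * cnj z1 - 2 * P * cnj z2) (K * cnj z1 - M * cnj z2)"
    proof (cases "z2 = 0")
      case True
      then show ?thesis
        using nz z by (simp add: inversion hom_pt_def)
    next
      case z2: False
      define d where "d = K * cnj z1 - M * cnj z2"
      have "z1 / z2 = M / K \<longleftrightarrow> K * z1 - M * z2 = 0"
        using nz z2 by (auto simp: field_simps)
      also have "\<dots> \<longleftrightarrow> cnj (K * z1 - M * z2) = 0" by (simp only: complex_cnj_zero_iff)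
      also have "cnj (K * z1 - M * z2) = d" by (simp add: d_def cnj_id)
      finally have iff: "z1 / z2 = M / K \<longleftrightarrow> d = 0" .
      have "M / K + (M\<^sup>2 - 2 * K * P) / K\<^sup>2 / (cnj z1 / cnj z2 - M / K) = (M * cnj z1 - 2 * P * cnj z2) / d"
        if "d \<noteq> 0"
      proof -
        have z1: "cnj z1 = (d + M * cnj z2) / K"
          using nz by (simp add: d_def)
        have "cnj z1 / cnj z2 - M / K = d / (K * cnj z2)"
          using nz z2 by (simp add: d_def field_simps)
        then have "M / K + (M\<^sup>2 - 2 * K * P) / K\<^sup>2 / (cnj z1 / cnj z2 - M / K)
            = M / K + (M\<^sup>2 - 2 * K * P) * cnj z2 / (K * d)"
          using nz by (simp add: power2_eq_square)
        also have "\<dots> = (M * cnj z1 - 2 * P * cnj z2) / d"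
          unfolding z1 using nz that by (simp add: field_simps power2_eq_square)
        finally show ?thesis .
      qed
      then show ?thesis
        using iff z2 by (auto simp: inversion hom_pt_def simp flip: d_def)
    qed
    then show ?thesis using lhs by (simp add: X defs mult.assoc)
  qed
qed

text \<open>Cramer's rule for the matrix of a reflection. It guarantees that the coordinates of a reflected
  point are again admissible as coordinates of a point.\<close>

lemma reflection_hom_pt_nonzero:
  fixes x1 x2 y1 y2 :: real
  assumes det: "x1 * y2 \<noteq> y1 * x2" and z: "z1 \<noteq> 0 \<or> z2 \<noteq> 0"
  shows "of_real (x1 * y2 + y1 * x2) * z1 - of_real (2 * x1 * y1) * z2 \<noteq> (0::complex) \<or>
         of_real (2 * x2 * y2) * z1 - of_real (x1 * y2 + y1 * x2) * z2 \<noteq> 0"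
    (is "?A \<noteq> 0 \<or> ?B \<noteq> 0")
proof (rule ccontr)
  assume "\<not> ?thesis"
  then have AB: "?A = 0" "?B = 0" by auto
  let ?D = "(of_real (x1 * y2 - y1 * x2))\<^sup>2 :: complex"
  have "?D * z1 = of_real (x1 * y2 + y1 * x2) * ?A - of_real (2 * x1 * y1) * ?B"
    "?D * z2 = of_real (2 * x2 * y2) * ?A - of_real (x1 * y2 + y1 * x2) * ?B"
    by (simp_all add: algebra_simps power2_eq_square)
  then have "?D * z1 = 0" "?D * z2 = 0" unfolding AB by simp_all
  moreover have "?D \<noteq> 0" using det by (metis of_real_eq_0_iff power_not_zero right_minus_eq)
  ultimately show False using z by simp
qed

lemma reflection_boundary:
  assumes "p \<in> H2_boundary" "q \<in> H2_boundary" "p \<noteq> q" "s \<in> H2_boundary"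
  shows "reflection p q s \<in> H2_boundary"
proof -
  obtain x1 x2 where p: "p = hom_pt (of_real x1) (of_real x2)" "x1 \<noteq> 0 \<or> x2 \<noteq> 0"
    using H2_boundary_cases assms(1) by blast
  obtain y1 y2 where q: "q = hom_pt (of_real y1) (of_real y2)" "y1 \<noteq> 0 \<or> y2 \<noteq> 0"
    using H2_boundary_cases assms(2) by blast
  obtain z1 z2 where s: "s = hom_pt (of_real z1) (of_real z2)" "z1 \<noteq> 0 \<or> z2 \<noteq> 0"
    using H2_boundary_cases assms(4) by blast
  have det: "x1 * y2 \<noteq> y1 * x2" using hom_pt_distinct_imp_det_nonzero assms(3) p q by metis
  have "reflection p q s = hom_pt (of_real ((x1 * y2 + y1 * x2) * z1 - (2 * x1 * y1) * z2))
             (of_real ((2 * x2 * y2) * z1 - (x1 * y2 + y1 * x2) * z2))"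
    unfolding p q s using reflection_hom_pt[OF det, of "of_real z1" "of_real z2"] s by simp
  then show ?thesis using hom_pt_real_in_boundary by metis
qed

section \<open>Symmetries of the modular tessellation\<close>

definition unit_inversion :: "complex proj_line \<Rightarrow> complex proj_line" where
  "unit_inversion = reflection (Fin (-1)) (Fin 1)"

definition translation :: "int \<Rightarrow> complex proj_line \<Rightarrow> complex proj_line" where
  "translation k = map_proj_line (\<lambda>z. of_int k + z)"

definition axis_reflection :: "complex proj_line \<Rightarrow> complex proj_line" where
  "axis_reflection = reflection Infty (Fin 0)"

lemma unit_inversion_hom_pt:
  assumes "u \<noteq> 0 \<or> v \<noteq> 0"
  shows "unit_inversion (hom_pt u v) = hom_pt (cnj v) (cnj u)"
proof -
  have "unit_inversion (hom_pt u v) = hom_pt (2 * cnj v) (2 * cnj u)"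
    using reflection_hom_pt[of "-1" 1 1 1 u v] assms
    by (simp add: unit_inversion_def hom_pt_def[of "-1" 1] hom_pt_def[of 1 1])
  then show ?thesis by (simp add: hom_pt_scale)
qed

lemma translation_hom_pt: "translation k (hom_pt u v) = hom_pt (u + of_int k * v) v"
  by (simp add: translation_def hom_pt_def field_simps)

lemma unit_inversion_simps [simp]:
  "unit_inversion Infty = Fin 0"
  "unit_inversion (Fin z) = (if z = 0 then Infty else Fin (1 / cnj z))"
  by (simp_all add: unit_inversion_def circle_inversion_def Let_def)

lemma translation_simps [simp]:
  "translation k Infty = Infty"
  "translation k (Fin z) = Fin (of_int k + z)"
  by (simp_all add: translation_def)

lemma axis_reflection_simps [simp]:
  "axis_reflection Infty = Infty"
  "axis_reflection (Fin z) = Fin (- cnj z)"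
  by (simp_all add: axis_reflection_def vertical_reflection_def)

lemma unit_inversion_involution [simp]: "unit_inversion (unit_inversion w) = w"
  by (cases w) auto

lemma axis_reflection_involution [simp]: "axis_reflection (axis_reflection w) = w"
  by (cases w) auto

lemma translation_translation [simp]: "translation k (translation l w) = translation (k + l) w"
  by (cases w) (auto simp: add.assoc)

lemma translation_0 [simp]: "translation 0 w = w"
  by (cases w) auto

lemma axis_reflection_unit_inversion:
  "axis_reflection (unit_inversion w) = unit_inversion (axis_reflection w)"
  by (cases w) auto

lemma axis_reflection_translation:
  "axis_reflection (translation k w) = translation (- k) (axis_reflection w)"
  by (cases w) auto

lemma reflection_Infty_int:
  "reflection Infty (Fin (of_int n)) w = translation (2 * n) (axis_reflection w)"
  by (cases w) (auto simp: vertical_reflection_def)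

text \<open>The third conjunct says that \<open>g\<close> conjugates edge reflections to edge reflections; it lets
  geometric statements be transported from \<open>\<infinity>\<close> to an arbitrary rational point.\<close>

definition tessellation_symmetry :: "(complex proj_line \<Rightarrow> complex proj_line) \<Rightarrow> bool" where
  "tessellation_symmetry g \<longleftrightarrow> inj g \<and> g ` H2_boundary \<subseteq> H2_boundary \<and>
     (\<forall>p\<in>H2_boundary. \<forall>q\<in>H2_boundary. p \<noteq> q \<longrightarrow>
        (\<forall>w. g (reflection p q w) = reflection (g p) (g q) (g w))) \<and>
     (\<forall>T\<in>modular_tessellation. g ` T \<in> modular_tessellation)"

lemma tessellation_symmetry_id: "tessellation_symmetry (\<lambda>w. w)"
  by (simp add: tessellation_symmetry_def)

lemma tessellation_symmetry_compose:
  assumes f: "tessellation_symmetry f" and g: "tessellation_symmetry g"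
  shows "tessellation_symmetry (\<lambda>w. f (g w))"
proof -
  have "inj (\<lambda>w. f (g w))"
    using f g inj_compose[of f g] by (simp add: tessellation_symmetry_def comp_def)
  moreover have "(\<lambda>w. f (g w)) ` H2_boundary \<subseteq> H2_boundary"
    using f g by (simp add: tessellation_symmetry_def image_subset_iff)
  moreover have "f (g (reflection p q w)) = reflection (f (g p)) (f (g q)) (f (g w))"
    if "p \<in> H2_boundary" "q \<in> H2_boundary" "p \<noteq> q" for p q w
  proof -
    have "g p \<in> H2_boundary" "g q \<in> H2_boundary" "g p \<noteq> g q"
      using g that unfolding tessellation_symmetry_def inj_def by blast+
    then show ?thesis using f g that by (simp add: tessellation_symmetry_def)
  qed
  moreover have "(\<lambda>w. f (g w)) ` T \<in> modular_tessellation" if "T \<in> modular_tessellation" for T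
  proof -
    have "f ` (g ` T) \<in> modular_tessellation" using f g that by (simp add: tessellation_symmetry_def)
    then show ?thesis by (simp only: image_image)
  qed
  ultimately show ?thesis by (simp add: tessellation_symmetry_def)
qed

text \<open>All triangles arise from the base triangle by reflections in edges, and \<open>g\<close> commutes with these
  in the sense of \<open>eqv\<close>. So only the image of the base triangle needs to be checked.\<close>

lemma tessellation_symmetryI:
  assumes "inj g" "g ` H2_boundary \<subseteq> H2_boundary"
    and eqv: "\<And>p q w. \<lbrakk>p \<in> H2_boundary; q \<in> H2_boundary; p \<noteq> q\<rbrakk>
                \<Longrightarrow> g (reflection p q w) = reflection (g p) (g q) (g w)"
    and base: "g ` base_triangle \<in> modular_tessellation"
  shows "tessellation_symmetry g"
proof -
  have "g ` T \<in> modular_tessellation" if "T \<in> modular_tessellation" for T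
    using that
  proof induction
    case base
    show ?case by fact
  next
    case (reflect T p q)
    have "g ` (reflection p q ` T) = reflection (g p) (g q) ` (g ` T)"
      using eqv[of p q] reflect.hyps by (simp add: image_image)
    moreover have "g p \<in> g ` T \<inter> H2_boundary" "g q \<in> g ` T \<inter> H2_boundary" "g p \<noteq> g q"
      using reflect.hyps assms(1,2) by (auto simp: inj_def)
    ultimately show ?case
      using modular_tessellation.reflect[OF reflect.IH] by metis
  qed
  then show ?thesis using assms unfolding tessellation_symmetry_def by blast
qed

text \<open>Exchanging the two coordinates of \<open>p\<close> and \<open>q\<close> conjugates the matrix of the reflection by the
  matrix of the exchange, up to a factor \<open>-1\<close>.\<close>

lemma unit_inversion_reflection:
  assumes "p \<in> H2_boundary" "q \<in> H2_boundary" "p \<noteq> q"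
  shows "unit_inversion (reflection p q w)
       = reflection (unit_inversion p) (unit_inversion q) (unit_inversion w)"
proof -
  obtain x1 x2 where p: "p = hom_pt (of_real x1) (of_real x2)" "x1 \<noteq> 0 \<or> x2 \<noteq> 0"
    using H2_boundary_cases assms(1) by blast
  obtain y1 y2 where q: "q = hom_pt (of_real y1) (of_real y2)" "y1 \<noteq> 0 \<or> y2 \<noteq> 0"
    using H2_boundary_cases assms(2) by blast
  obtain z1 z2 where w: "w = hom_pt z1 z2" "z1 \<noteq> 0 \<or> z2 \<noteq> 0"
    using hom_pt_cases by blast
  have det: "x1 * y2 \<noteq> y1 * x2" using hom_pt_distinct_imp_det_nonzero assms(3) p q by metis
  then have det': "x2 * y1 \<noteq> y2 * x1" by (simp add: mult.commute)
  have z': "cnj z2 \<noteq> 0 \<or> cnj z1 \<noteq> 0" "cnj z1 \<noteq> 0 \<or> cnj z2 \<noteq> 0" using w by auto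
  have "unit_inversion (reflection p q w)
     = hom_pt (of_real (2 * x2 * y2) * z1 - of_real (x1 * y2 + y1 * x2) * z2)
              (of_real (x1 * y2 + y1 * x2) * z1 - of_real (2 * x1 * y1) * z2)"
    unfolding p(1) q(1) w(1) reflection_hom_pt[OF det w(2)]
      unit_inversion_hom_pt[OF reflection_hom_pt_nonzero[OF det z'(2)]] by simp
  moreover have "reflection (unit_inversion p) (unit_inversion q) (unit_inversion w)
     = hom_pt (of_real (x2 * y1 + y2 * x1) * z2 - of_real (2 * x2 * y2) * z1)
              (of_real (2 * x1 * y1) * z2 - of_real (x2 * y1 + y2 * x1) * z1)"
    using p q w reflection_hom_pt[OF det' z'(1)] by (simp add: unit_inversion_hom_pt)
  moreover have "of_real (x2 * y1 + y2 * x1) * z2 - of_real (2 * x2 * y2) * z1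
      = - (of_real (2 * x2 * y2) * z1 - of_real (x1 * y2 + y1 * x2) * z2)"
    "of_real (2 * x1 * y1) * z2 - of_real (x2 * y1 + y2 * x1) * z1
      = - (of_real (x1 * y2 + y1 * x2) * z1 - of_real (2 * x1 * y1) * z2)"
    by (simp_all add: algebra_simps)
  ultimately show ?thesis by (simp only: hom_pt_uminus)
qed

lemma translation_reflection:
  assumes "p \<in> H2_boundary" "q \<in> H2_boundary" "p \<noteq> q"
  shows "translation k (reflection p q w)
       = reflection (translation k p) (translation k q) (translation k w)"
proof -
  obtain x1 x2 where p: "p = hom_pt (of_real x1) (of_real x2)" "x1 \<noteq> 0 \<or> x2 \<noteq> 0"
    using H2_boundary_cases assms(1) by blast
  obtain y1 y2 where q: "q = hom_pt (of_real y1) (of_real y2)" "y1 \<noteq> 0 \<or> y2 \<noteq> 0"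
    using H2_boundary_cases assms(2) by blast
  obtain z1 z2 where w: "w = hom_pt z1 z2" "z1 \<noteq> 0 \<or> z2 \<noteq> 0"
    using hom_pt_cases by blast
  have det: "x1 * y2 \<noteq> y1 * x2" using hom_pt_distinct_imp_det_nonzero assms(3) p q by metis
  have det': "(x1 + of_int k * x2) * y2 \<noteq> (y1 + of_int k * y2) * x2"
    using det by (simp add: algebra_simps)
  have z': "z1 + of_int k * z2 \<noteq> 0 \<or> z2 \<noteq> 0" using w by auto
  have tr: "translation k (hom_pt (of_real u) (of_real v))
      = hom_pt (of_real (u + of_int k * v)) (of_real v)" for u v
    by (simp add: translation_hom_pt)
  show ?thesis
    unfolding p(1) q(1) w(1) tr translation_hom_pt[of k z1 z2]
      reflection_hom_pt[OF det' z'] reflection_hom_pt[OF det w(2)]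
    unfolding translation_hom_pt
    by (rule arg_cong2[where f = hom_pt]) (simp_all add: algebra_simps)
qed

text \<open>Inversion in the unit circle fixes the vertex \<open>1\<close> and exchanges \<open>0\<close> and \<open>\<infinity>\<close>. Of the sides, it
  exchanges the line \<open>Re z = 1\<close> and the semicircle \<open>Re z = \<bar>z\<bar>\<^sup>2\<close> and preserves the imaginary axis.\<close>

lemma unit_inversion_base_triangle: "unit_inversion ` base_triangle = base_triangle"
proof -
  have disc: "cmod (z - 1 / 2) \<ge> 1 / 2 \<longleftrightarrow> Re z \<le> (Re z)\<^sup>2 + (Im z)\<^sup>2" for z
  proof -
    have "cmod (z - 1 / 2) \<ge> 1 / 2 \<longleftrightarrow> (cmod (z - 1 / 2))\<^sup>2 \<ge> (1 / 2)\<^sup>2"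
      by (metis abs_le_square_iff abs_norm_cancel abs_of_pos half_gt_zero_iff zero_less_one)
    also have "(cmod (z - 1 / 2))\<^sup>2 = (Re z)\<^sup>2 + (Im z)\<^sup>2 - Re z + (1 / 2)\<^sup>2"
      unfolding cmod_power2 by (simp add: power2_eq_square algebra_simps)
    finally show ?thesis by simp
  qed
  have "unit_inversion w \<in> base_triangle" if "w \<in> base_triangle" for w
  proof (cases w)
    case Infty
    then show ?thesis by (simp add: base_triangle_def norm_divide)
  next
    case (Fin z)
    show ?thesis
    proof (cases "z = 0")
      case True
      then show ?thesis using Fin by (simp add: base_triangle_def)
    next
      case False
      define N where "N = (Re z)\<^sup>2 + (Im z)\<^sup>2"
      have N: "N > 0" using False by (simp add: N_def complex_neq_0)
      have z: "Im z \<ge> 0" "0 \<le> Re z" "Re z \<le> 1" "Re z \<le> N"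
        using that Fin disc by (auto simp: base_triangle_def N_def)
      have re: "Re (1 / cnj z) = Re z / N" and im: "Im (1 / cnj z) = Im z / N"
        by (simp_all add: Re_divide Im_divide N_def)
      have "(Re z / N)\<^sup>2 + (Im z / N)\<^sup>2 = N / N\<^sup>2"
        by (simp add: N_def power_divide add_divide_distrib)
      also have "\<dots> = 1 / N" using N by (simp add: power2_eq_square)
      finally have "Re (1 / cnj z) \<le> (Re (1 / cnj z))\<^sup>2 + (Im (1 / cnj z))\<^sup>2"
        unfolding re im using N z by (simp add: divide_right_mono)
      then have "cmod (1 / cnj z - 1 / 2) \<ge> 1 / 2" by (simp only: disc)
      moreover have "Im (1 / cnj z) \<ge> 0" "0 \<le> Re (1 / cnj z)" "Re (1 / cnj z) \<le> 1"
        unfolding re im using N z by simp_all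
      ultimately show ?thesis using Fin False by (simp add: base_triangle_def)
    qed
  qed
  then show ?thesis by (metis image_eqI image_subsetI subsetI subset_antisym unit_inversion_involution)
qed

lemma mirror_base_triangle: "map_proj_line (\<lambda>z. 1 - cnj z) ` base_triangle = base_triangle"
proof -
  let ?R = "map_proj_line (\<lambda>z. 1 - cnj z)"
  have "cmod (1 / 2 - cnj z) = cmod (z - 1 / 2)" for z
  proof -
    have "1 / 2 - cnj z = - cnj (z - 1 / 2)" by simp
    then show ?thesis by (metis complex_mod_cnj norm_minus_cancel)
  qed
  then have "?R w \<in> base_triangle" if "w \<in> base_triangle" for w
    using that by (cases w) (auto simp: base_triangle_def)
  moreover have "?R (?R w) = w" for w by (cases w) auto
  ultimately show ?thesis by (metis image_eqI image_subsetI subsetI subset_antisym)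
qed

lemma tessellation_symmetry_unit_inversion: "tessellation_symmetry unit_inversion"
proof (rule tessellation_symmetryI)
  show "inj unit_inversion" by (metis injI unit_inversion_involution)
  show "unit_inversion ` H2_boundary \<subseteq> H2_boundary"
    by (auto simp: H2_boundary_def Im_divide)
qed (simp_all add: unit_inversion_reflection unit_inversion_base_triangle modular_tessellation.base)

text \<open>The base triangle has the mirror symmetry \<open>z \<mapsto> 1 - cnj z\<close>. Hence its translates by \<open>1\<close> and
  \<open>-1\<close> coincide with its reflections in the sides over \<open>1\<close> and \<open>0\<close>, and these two translations
  generate all others.\<close>

lemma tessellation_symmetry_translation: "tessellation_symmetry (translation k)"
proof -
  \<comment> \<open>\<open>n = 1\<close> gives the translation by \<open>1\<close> and \<open>n = 0\<close> the translation by \<open>-1\<close>.\<close>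
  have base_step: "translation (2 * n - 1) ` base_triangle \<in> modular_tessellation"
    if n: "n = 0 \<or> n = 1" for n :: int
  proof -
    have "translation (2 * n - 1) (map_proj_line (\<lambda>z. 1 - cnj z) w)
        = reflection Infty (Fin (of_int n)) w" for w
      by (cases w) (simp_all add: vertical_reflection_def)
    then have "translation (2 * n - 1) ` base_triangle = reflection Infty (Fin (of_int n)) ` base_triangle"
      by (subst mirror_base_triangle[symmetric]) (simp add: image_image)
    moreover have "Infty \<in> base_triangle \<inter> H2_boundary" "Fin (of_int n) \<in> base_triangle \<inter> H2_boundary"
      unfolding base_triangle_vertices using n by auto
    ultimately show ?thesis
      using modular_tessellation.reflect[OF modular_tessellation.base, of Infty "Fin (of_int n)"] by simp
  qed
  have sym: "tessellation_symmetry (translation j)"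
    if "translation j ` base_triangle \<in> modular_tessellation" for j
  proof (rule tessellation_symmetryI)
    show "inj (translation j)"
      by (rule inj_on_inverseI[where g = "translation (- j)"]) simp
    show "translation j ` H2_boundary \<subseteq> H2_boundary" by (auto simp: H2_boundary_def)
  qed (use that translation_reflection in auto)
  have 1: "tessellation_symmetry (translation 1)" using sym[of 1] base_step[of 1] by simp
  have m1: "tessellation_symmetry (translation (-1))" using sym[of "-1"] base_step[of 0] by simp
  show ?thesis
  proof (induction k rule: int_induct[where k = 0])
    case base
    then show ?case using tessellation_symmetry_id by simp
  next
    case (step1 i)
    have "translation (i + 1) = (\<lambda>w. translation 1 (translation i w))" by (auto simp: add.commute)
    then show ?case using tessellation_symmetry_compose[OF 1 step1(2)] by simp
  next
    case (step2 i)
    have "translation (i - 1) = (\<lambda>w. translation (-1) (translation i w))" by auto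
    then show ?case using tessellation_symmetry_compose[OF m1 step2(2)] by simp
  qed
qed

lemma tess_edge_symmetry:
  assumes g: "tessellation_symmetry g" and "tess_edge p q"
  shows "tess_edge (g p) (g q)"
proof -
  obtain T where T: "p \<noteq> q" "T \<in> modular_tessellation" "p \<in> T \<inter> H2_boundary" "q \<in> T \<inter> H2_boundary"
    using assms(2) by (auto simp: tess_edge_def)
  have "g p \<noteq> g q" "g ` T \<in> modular_tessellation" "g p \<in> g ` T \<inter> H2_boundary" "g q \<in> g ` T \<inter> H2_boundary"
    using g T by (auto simp: tessellation_symmetry_def inj_def)
  then show ?thesis by (auto simp: tess_edge_def)
qed

section \<open>Edges of the tessellation\<close>

text \<open>The determinant condition on reduced fractions. It holds for the endpoints of every edge, and this
  forces the endpoints of the edges at \<open>\<infinity>\<close> to be integers.\<close>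

definition farey_neighbours :: "complex proj_line \<Rightarrow> complex proj_line \<Rightarrow> bool" where
  "farey_neighbours p q \<longleftrightarrow> (\<exists>a b c d :: int. p = hom_pt (of_int a) (of_int b) \<and>
     q = hom_pt (of_int c) (of_int d) \<and> \<bar>a * d - c * b\<bar> = 1)"

text \<open>If \<open>p\<close> and \<open>q\<close> are neighbours, the matrix of the reflection is integral of determinant \<open>-1\<close>, so
  that it preserves determinants of pairs of integer vectors up to sign.\<close>

lemma farey_neighbours_reflection:
  assumes "farey_neighbours p q" "farey_neighbours s t"
  shows "farey_neighbours (reflection p q s) (reflection p q t)"
proof -
  obtain x1 x2 y1 y2 :: int where
    p: "p = hom_pt (of_int x1) (of_int x2)" and q: "q = hom_pt (of_int y1) (of_int y2)"
    and xy: "\<bar>x1 * y2 - y1 * x2\<bar> = 1"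
    using assms(1) by (auto simp: farey_neighbours_def)
  obtain s1 s2 t1 t2 :: int where
    s: "s = hom_pt (of_int s1) (of_int s2)" and t: "t = hom_pt (of_int t1) (of_int t2)"
    and st: "\<bar>s1 * t2 - t1 * s2\<bar> = 1"
    using assms(2) by (auto simp: farey_neighbours_def)
  have det: "real_of_int x1 * real_of_int y2 \<noteq> real_of_int y1 * real_of_int x2"
    using xy by (auto simp flip: of_int_mult)
  define U where "U u v = (x1 * y2 + y1 * x2) * u - 2 * x1 * y1 * v" for u v
  define V where "V u v = 2 * x2 * y2 * u - (x1 * y2 + y1 * x2) * v" for u v
  have refl: "reflection p q (hom_pt (of_int u) (of_int v)) = hom_pt (of_int (U u v)) (of_int (V u v))"
    if "u \<noteq> 0 \<or> v \<noteq> 0" for u v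
    unfolding p q using reflection_hom_pt[OF det, of "of_int u" "of_int v"] that
    by (simp add: U_def V_def)
  have "s1 \<noteq> 0 \<or> s2 \<noteq> 0" "t1 \<noteq> 0 \<or> t2 \<noteq> 0" using st by auto
  then have "reflection p q s = hom_pt (of_int (U s1 s2)) (of_int (V s1 s2))"
    "reflection p q t = hom_pt (of_int (U t1 t2)) (of_int (V t1 t2))"
    unfolding s t by (simp_all add: refl)
  moreover have "U s1 s2 * V t1 t2 - U t1 t2 * V s1 s2
      = - ((x1 * y2 - y1 * x2) * (x1 * y2 - y1 * x2) * (s1 * t2 - t1 * s2))"
    by (simp add: U_def V_def algebra_simps)
  then have "\<bar>U s1 s2 * V t1 t2 - U t1 t2 * V s1 s2\<bar> = 1"
    using xy st by (simp add: abs_mult)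
  ultimately show ?thesis unfolding farey_neighbours_def by blast
qed

lemma tess_edge_imp_farey_neighbours:
  assumes "tess_edge p q"
  shows "farey_neighbours p q"
proof -
  have "\<forall>s \<in> T \<inter> H2_boundary. \<forall>t \<in> T \<inter> H2_boundary. s \<noteq> t \<longrightarrow> farey_neighbours s t"
    if "T \<in> modular_tessellation" for T
    using that
  proof induction
    case base
    have pts: "Fin 0 = hom_pt (of_int 0) (of_int 1)" "Fin 1 = hom_pt (of_int 1) (of_int 1)"
      "Infty = hom_pt (of_int 1) (of_int 0)"
      by (simp_all add: hom_pt_def)
    have fn: "farey_neighbours (hom_pt (of_int a) (of_int b)) (hom_pt (of_int c) (of_int d))"
      if "\<bar>a * d - c * b\<bar> = 1" for a b c d
      using that unfolding farey_neighbours_def by blast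
    have "farey_neighbours (Fin 0) (Fin 1)" "farey_neighbours (Fin 1) (Fin 0)"
      "farey_neighbours (Fin 0) Infty" "farey_neighbours Infty (Fin 0)"
      "farey_neighbours (Fin 1) Infty" "farey_neighbours Infty (Fin 1)"
      unfolding pts by (rule fn, simp)+
    then show ?case unfolding base_triangle_vertices by blast
  next
    case (reflect T p q)
    have pq: "p \<in> H2_boundary" "q \<in> H2_boundary" "p \<noteq> q" using reflect.hyps by auto
    have preimage: "\<exists>s' \<in> T \<inter> H2_boundary. s = reflection p q s'"
      if s: "s \<in> (reflection p q ` T) \<inter> H2_boundary" for s
    proof -
      obtain s' where s': "s' \<in> T" "s = reflection p q s'" using s by auto
      then have "s' = reflection p q s" using reflection_involution[OF pq] by simp
      then show ?thesis using s' reflection_boundary[OF pq, of s] s by auto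
    qed
    have "farey_neighbours p q" using reflect by blast
    then show ?case
      using preimage reflect.IH farey_neighbours_reflection by metis
  qed
  then show ?thesis using assms by (auto simp: tess_edge_def)
qed

text \<open>A neighbour \<open>c / d\<close> of \<open>\<infinity> = \<plusminus>1 / 0\<close> has \<open>\<bar>d\<bar> = 1\<close>; conversely, translations move the side
  of the base triangle from \<open>0\<close> to \<open>\<infinity>\<close> over every integer.\<close>

lemma tess_edge_Infty_iff: "tess_edge Infty q \<longleftrightarrow> (\<exists>n::int. q = Fin (of_int n))"
proof
  assume "tess_edge Infty q"
  then obtain a b c d :: int where "Infty = hom_pt (of_int a) (of_int b)"
    and q: "q = hom_pt (of_int c) (of_int d)" and det: "\<bar>a * d - c * b\<bar> = 1"
    using tess_edge_imp_farey_neighbours unfolding farey_neighbours_def by blast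
  then have "b = 0" by (auto simp: hom_pt_def split: if_splits)
  then have "d dvd 1" using det by (metis abs_dvd_iff diff_zero dvd_abs_iff dvd_triv_right mult_zero_right)
  then have "d = 1 \<or> d = -1" by auto
  then have "q = Fin (of_int (c * d))" using q by (auto simp: hom_pt_def)
  then show "\<exists>n::int. q = Fin (of_int n)" by blast
next
  assume "\<exists>n::int. q = Fin (of_int n)"
  then obtain n :: int where q: "q = translation n (Fin 0)" by auto
  have "tess_edge Infty (Fin 0)"
    unfolding tess_edge_def
    by (rule conjI[OF _ bexI[OF _ modular_tessellation.base]]) (auto simp: base_triangle_vertices)
  then show "tess_edge Infty q"
    using tess_edge_symmetry[OF tessellation_symmetry_translation, of Infty "Fin 0" n] q by simp
qed

section \<open>The isometry of a continued fraction\<close>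

text \<open>The isometry \<open>W\<^sub>a\<close>. The innermost inversion is present also for the empty sequence, so that the
  value of the continued fraction is the image of \<open>\<infinity>\<close>, and consecutive blocks of a sequence are
  separated by a translation only.\<close>

fun cfrac_isometry :: "int list \<Rightarrow> complex proj_line \<Rightarrow> complex proj_line" where
  "cfrac_isometry [] w = unit_inversion w"
| "cfrac_isometry (a # as) w = unit_inversion (translation a (cfrac_isometry as w))"

lemma ideal_point_cfrac: "ideal_point (cfrac as) = cfrac_isometry as Infty"
proof (induction as)
  case Nil
  then show ?case by (simp add: ideal_point_def)
next
  case (Cons a as)
  have "ideal_point (proj_inverse (proj_add_int a x)) = unit_inversion (translation a (ideal_point x))" for x
  proof (cases x)
    case (Fin q)
    have c: "of_int a + of_rat q = (of_rat (of_int a + q) :: complex)" by (simp add: of_rat_add)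
    have "cnj (of_rat s) = of_rat s" for s
      by (cases s) (simp add: of_rat_rat)
    then show ?thesis
      unfolding Fin by (simp add: ideal_point_def proj_add_int_def proj_inverse_def c of_rat_divide)
  qed (simp add: ideal_point_def proj_add_int_def proj_inverse_def)
  with Cons show ?case by simp
qed

lemma cfrac_isometry_append:
  "cfrac_isometry (xs @ b # ys) w = cfrac_isometry xs (translation b (cfrac_isometry ys w))"
  by (induction xs) auto

lemma cfrac_isometry_map_uminus:
  "cfrac_isometry (map uminus xs) w = axis_reflection (cfrac_isometry xs (axis_reflection w))"
  by (induction xs) (simp_all add: axis_reflection_unit_inversion axis_reflection_translation)

text \<open>The inverse of \<open>J A\<^bsup>a\<^sub>1\<^esup> J \<dots> A\<^bsup>a\<^sub>m\<^esup> J\<close> is \<open>J A\<^bsup>-a\<^sub>m\<^esup> J \<dots> A\<^bsup>-a\<^sub>1\<^esup> J\<close>, since \<open>J\<close> is an involution.\<close>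

lemma cfrac_isometry_rev_uminus:
  "cfrac_isometry (rev xs) (cfrac_isometry (map uminus xs) w) = w"
  by (induction xs) (simp_all add: cfrac_isometry_append)

lemma cfrac_isometry_inverse:
  "cfrac_isometry (map uminus (rev xs)) (cfrac_isometry xs w) = w"
  "cfrac_isometry xs (cfrac_isometry (map uminus (rev xs)) w) = w"
proof -
  show "cfrac_isometry xs (cfrac_isometry (map uminus (rev xs)) w) = w"
    using cfrac_isometry_rev_uminus[of "rev xs" w] by simp
  have "map uminus (map uminus xs) = xs" by (simp add: map_idI)
  then show "cfrac_isometry (map uminus (rev xs)) (cfrac_isometry xs w) = w"
    using cfrac_isometry_rev_uminus[of "map uminus xs" w] by (simp add: rev_map)
qed

lemma tessellation_symmetry_cfrac_isometry: "tessellation_symmetry (cfrac_isometry as)"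
proof (induction as)
  case Nil
  then show ?case using tessellation_symmetry_unit_inversion by simp
next
  case (Cons a as)
  have "cfrac_isometry (a # as) = (\<lambda>w. unit_inversion (translation a (cfrac_isometry as w)))"
    by auto
  then show ?case
    using tessellation_symmetry_compose[OF tessellation_symmetry_unit_inversion
        tessellation_symmetry_compose[OF tessellation_symmetry_translation Cons]] by simp
qed

text \<open>Transport of \<open>tess_edge_Infty_iff\<close> by \<open>W\<^sub>a\<close>. Together with the next lemma it identifies \<open>\<Gamma>\<^sub>r\<close>
  with the conjugate of \<open>\<Gamma>\<^sub>\<infinity>\<close>, on generators.\<close>

lemma tess_edge_cfrac_isometry_iff:
  "tess_edge (cfrac_isometry as Infty) q \<longleftrightarrow> (\<exists>n::int. q = cfrac_isometry as (Fin (of_int n)))"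
proof
  let ?g = "cfrac_isometry as" and ?h = "cfrac_isometry (map uminus (rev as))"
  assume "tess_edge (?g Infty) q"
  then have "tess_edge (?h (?g Infty)) (?h q)"
    by (rule tess_edge_symmetry[OF tessellation_symmetry_cfrac_isometry])
  then obtain n :: int where "?h q = Fin (of_int n)"
    unfolding cfrac_isometry_inverse tess_edge_Infty_iff by blast
  then have "q = ?g (Fin (of_int n))" by (metis cfrac_isometry_inverse(2))
  then show "\<exists>n::int. q = ?g (Fin (of_int n))" by blast
next
  assume "\<exists>n::int. q = cfrac_isometry as (Fin (of_int n))"
  then show "tess_edge (cfrac_isometry as Infty) q"
    using tess_edge_symmetry[OF tessellation_symmetry_cfrac_isometry] tess_edge_Infty_iff by blast
qed

lemma reflection_cfrac_isometry:
  "reflection (cfrac_isometry as Infty) (cfrac_isometry as (Fin (of_int n))) (cfrac_isometry as w)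
     = cfrac_isometry as (translation (2 * n) (axis_reflection w))"
proof -
  have "Infty \<in> H2_boundary" "Fin (of_int n) \<in> H2_boundary" "Infty \<noteq> Fin (of_int n :: complex)"
    by (auto simp: H2_boundary_def)
  then have "cfrac_isometry as (reflection Infty (Fin (of_int n)) w)
      = reflection (cfrac_isometry as Infty) (cfrac_isometry as (Fin (of_int n))) (cfrac_isometry as w)"
    using tessellation_symmetry_cfrac_isometry[of as] unfolding tessellation_symmetry_def by blast
  then show ?thesis by (simp only: reflection_Infty_int)
qed

section \<open>Orbits of groups generated by edge reflections\<close>

lemma subgroup_setwise_stabilizer:
  assumes "U \<subseteq> S"
  shows "subgroup {g \<in> Bij S. g ` U = U} (BijGroup S)"
proof (rule group.subgroupI[OF group_BijGroup])
  show "{g \<in> Bij S. g ` U = U} \<noteq> {}"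
    using id_Bij[of S] assms by (auto intro!: exI[of _ "\<lambda>x\<in>S. x"] simp: subset_iff)
  fix g assume g: "g \<in> {g \<in> Bij S. g ` U = U}"
  have "inj_on g S" using g by (auto simp: Bij_def bij_betw_def)
  then have "inv_into S g ` (g ` U) = U" using assms by (rule inv_into_image_cancel)
  moreover have "restrict (inv_into S g) S ` U = inv_into S g ` U"
    using assms by (intro image_cong) auto
  ultimately show "inv\<^bsub>BijGroup S\<^esub> g \<in> {g \<in> Bij S. g ` U = U}"
    using g inv_BijGroup[of g S] restrict_inv_into_Bij[of g S] by auto
  fix h assume h: "h \<in> {g \<in> Bij S. g ` U = U}"
  have "compose S g h ` U = g ` (h ` U)"
    unfolding image_image using assms by (intro image_cong) (auto simp: compose_def)
  then show "g \<otimes>\<^bsub>BijGroup S\<^esub> h \<in> {g \<in> Bij S. g ` U = U}"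
    using g h compose_Bij[of g S h] by (simp add: BijGroup_def)
qed (auto simp: BijGroup_def)

lemma ideal_point_boundary: "ideal_point x \<in> H2_boundary"
proof (cases x)
  case (Fin q)
  have "Im (of_rat q) = 0" by (cases q) (simp add: of_rat_rat)
  then show ?thesis using Fin by (simp add: ideal_point_def H2_boundary_def)
qed (simp add: ideal_point_def H2_boundary_def)

lemma H2_boundary_subset_closed: "H2_boundary \<subseteq> H2_closed"
  by (auto simp: H2_boundary_def H2_closed_def)

lemma tess_edge_boundary:
  assumes "tess_edge p q"
  shows "p \<in> H2_boundary" "q \<in> H2_boundary" "p \<noteq> q"
  using assms by (auto simp: tess_edge_def)

lemma edge_reflection_in_Gamma:
  assumes "tess_edge (ideal_point r) q"
  shows "restrict (reflection (ideal_point r) q) H2_closed \<in> carrier (Gamma r)"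
  using assms reflection_in_BijGroup[OF tess_edge_boundary[OF assms]]
  unfolding Gamma_def carrier_subgroup_generated by (blast intro: generate.incl)

lemma Gamma_subset_Gamma_hat:
  "carrier (Gamma r) \<union> carrier (Gamma Infty) \<subseteq> carrier (Gamma_hat r)"
proof -
  have "carrier (Gamma s) \<subseteq> carrier (BijGroup H2_closed)" for s
    unfolding Gamma_def by (rule group.carrier_subgroup_generated_subset[OF group_BijGroup])
  then show ?thesis
    unfolding Gamma_hat_def
    by (intro group.subgroup_generated_subset_carrier_subset[OF group_BijGroup]) blast
qed

lemma Gamma_hat_orbit_self: "ideal_point x \<in> Gamma_hat_orbit r x"
proof -
  have "\<one>\<^bsub>BijGroup H2_closed\<^esub> \<in> carrier (Gamma_hat r)"
    unfolding Gamma_hat_def carrier_subgroup_generated by (rule generate.one)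
  moreover have "\<one>\<^bsub>BijGroup H2_closed\<^esub> (ideal_point x) = ideal_point x"
    using ideal_point_boundary H2_boundary_subset_closed by (auto simp: BijGroup_def)
  ultimately show ?thesis unfolding Gamma_hat_orbit_def orbit_def by (metis (mono_tags, lifting) mem_Collect_eq)
qed

lemma Gamma_hat_orbit_reflection:
  assumes s: "s = r \<or> s = Infty" and edge: "tess_edge (ideal_point s) q"
    and y: "y \<in> Gamma_hat_orbit r x"
  shows "reflection (ideal_point s) q y \<in> Gamma_hat_orbit r x"
proof -
  let ?B = "BijGroup H2_closed" and ?g = "restrict (reflection (ideal_point s) q) H2_closed"
  have g: "?g \<in> carrier (Gamma_hat r)"
    using edge_reflection_in_Gamma[OF edge] Gamma_subset_Gamma_hat s by blast
  obtain h where h: "h \<in> carrier (Gamma_hat r)" "y = h (ideal_point x)"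
    using y by (auto simp: Gamma_hat_orbit_def orbit_def)
  have sub: "carrier (Gamma_hat r) \<subseteq> Bij H2_closed"
    using group.carrier_subgroup_generated_subset[OF group_BijGroup]
    by (simp add: Gamma_hat_def BijGroup_def)
  have x: "ideal_point x \<in> H2_closed"
    using ideal_point_boundary H2_boundary_subset_closed by blast
  then have "y \<in> H2_closed" using h sub Bij_imp_funcset by blast
  then have "(?g \<otimes>\<^bsub>?B\<^esub> h) (ideal_point x) = reflection (ideal_point s) q y"
    using g h x sub by (auto simp: BijGroup_def compose_def)
  moreover have "?g \<otimes>\<^bsub>?B\<^esub> h \<in> carrier (Gamma_hat r)"
    using g h(1) unfolding Gamma_hat_def carrier_subgroup_generated by (rule generate.eng)
  ultimately show ?thesis unfolding Gamma_hat_orbit_def orbit_def by (metis (mono_tags, lifting) mem_Collect_eq)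
qed

text \<open>The elements of the group of bijections that map \<open>V\<close>, cut down to the closed half plane, onto itself
  form a subgroup. The generating reflections belong to it: as involutions they map a set onto
  itself as soon as they map it into itself.\<close>

lemma Gamma_hat_orbit_subset:
  assumes x: "ideal_point x \<in> V"
    and closed: "\<And>s q v. \<lbrakk>s = r \<or> s = Infty; tess_edge (ideal_point s) q; v \<in> V\<rbrakk>
                   \<Longrightarrow> reflection (ideal_point s) q v \<in> V"
  shows "Gamma_hat_orbit r x \<subseteq> V"
proof -
  define U where "U = V \<inter> H2_closed"
  define K where "K = {g \<in> Bij H2_closed. g ` U = U}"
  have K: "subgroup K (BijGroup H2_closed)"
    unfolding K_def by (rule subgroup_setwise_stabilizer) (simp add: U_def)
  have gen: "restrict (reflection (ideal_point s) q) H2_closed \<in> K"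
    if s: "s = r \<or> s = Infty" and edge: "tess_edge (ideal_point s) q" for s q
  proof -
    let ?f = "reflection (ideal_point s) q"
    note pq = tess_edge_boundary[OF edge]
    have "?f v \<in> U" if "v \<in> U" for v
      using closed[OF s edge] reflection_closed[OF pq(1,2)] that by (simp add: U_def)
    moreover have "?f (?f v) = v" for v by (rule reflection_involution[OF pq])
    ultimately have "?f ` U = U" by (metis image_eqI image_subsetI subsetI subset_antisym)
    moreover have "restrict ?f H2_closed ` U = ?f ` U"
      by (rule image_cong) (auto simp: U_def)
    ultimately show ?thesis
      using reflection_in_BijGroup[OF pq] by (simp add: K_def BijGroup_def)
  qed
  have "carrier (Gamma s) \<subseteq> K" if "s = r \<or> s = Infty" for s
    unfolding Gamma_def using gen[OF that]
    by (intro group.subgroup_generated_minimal[OF group_BijGroup K]) blast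
  then have "carrier (Gamma_hat r) \<subseteq> K"
    unfolding Gamma_hat_def
    by (intro group.subgroup_generated_minimal[OF group_BijGroup K]) blast
  moreover have "ideal_point x \<in> U"
    using x ideal_point_boundary H2_boundary_subset_closed by (auto simp: U_def)
  ultimately show ?thesis by (auto simp: Gamma_hat_orbit_def orbit_def K_def U_def)
qed

section \<open>The set of values of the expansions\<close>

text \<open>The sequences of the theorem, built from the right. After removal of the first block, the rest is
  a sequence of the same kind for the reversed \<open>a\<close>, and this is the recursion that matches
  \<open>W\<^sub>a\<close> and \<open>W\<^sub>a\<^sup>-\<^sup>1\<close> taking turns.\<close>

inductive expansion_of :: "int list \<Rightarrow> int list \<Rightarrow> bool" where
  block: "e \<in> {1, -1} \<Longrightarrow> expansion_of a (map ((*) e) a)"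
| cons_block: "\<lbrakk>e \<in> {1, -1}; expansion_of (rev a) l\<rbrakk>
    \<Longrightarrow> expansion_of a (map ((*) e) a @ (2 * c) # l)"

lemma signed_block_rev: "signed_block (rev a) (\<lambda>i. \<epsilon> (Suc i)) i = signed_block a \<epsilon> (Suc i)"
  by (simp add: signed_block_def)

lemma expansion_seq_Suc:
  assumes "n > 0"
  shows "expansion_seq a (Suc n) \<epsilon> c =
    signed_block a \<epsilon> 1 @ (2 * c 1) # expansion_seq (rev a) n (\<lambda>i. \<epsilon> (Suc i)) (\<lambda>i. c (Suc i))"
proof -
  have "[1..<Suc n] = 1 # map Suc [1..<n]"
    using assms by (simp add: map_Suc_upt upt_conv_Cons del: upt_Suc)
  then show ?thesis
    by (simp add: expansion_seq_def signed_block_rev comp_def del: upt_Suc)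
qed

lemma expansion_seq_cong:
  assumes "\<And>i. i > 0 \<Longrightarrow> \<epsilon> i = \<epsilon>' i" "\<And>i. i > 0 \<Longrightarrow> c i = c' i"
  shows "expansion_seq a n \<epsilon> c = expansion_seq a n \<epsilon>' c'"
proof -
  have "signed_block a \<epsilon> (Suc i) = signed_block a \<epsilon>' (Suc i)" for i
    using assms by (simp add: signed_block_def)
  then show ?thesis
    using assms unfolding expansion_seq_def
    by (intro arg_cong2[where f = "(@)"] arg_cong[where f = concat] map_cong) auto
qed

lemma expansion_of_iff:
  "expansion_of a l \<longleftrightarrow>
    (\<exists>n \<epsilon> c. n > 0 \<and> (\<forall>i\<in>{1..n}. \<epsilon> i \<in> {1, -1}) \<and> l = expansion_seq a n \<epsilon> c)"
proof
  assume "expansion_of a l"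
  then show "\<exists>n \<epsilon> c. n > 0 \<and> (\<forall>i\<in>{1..n}. \<epsilon> i \<in> {1, -1}) \<and> l = expansion_seq a n \<epsilon> c"
  proof induction
    case (block e a)
    then show ?case
      by (intro exI[of _ 1] exI[of _ "\<lambda>_. e"]) (simp add: expansion_seq_def signed_block_def)
  next
    case (cons_block e a l d)
    then obtain n \<epsilon> c where n: "n > 0" and \<epsilon>: "\<forall>i\<in>{1..n}. \<epsilon> i \<in> {1, -1}"
      and l: "l = expansion_seq (rev a) n \<epsilon> c"
      by blast
    \<comment> \<open>Indices start at \<open>1\<close>, so prepending a block shifts them by one and leaves the value at \<open>0\<close>
      arbitrary.\<close>
    define \<epsilon>' where "\<epsilon>' i = (if i = 1 then e else \<epsilon> (i - 1))" for i
    define c' where "c' i = (if i = 1 then d else c (i - 1))" for i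
    have "expansion_seq (rev a) n (\<lambda>i. \<epsilon>' (Suc i)) (\<lambda>i. c' (Suc i)) = l"
      unfolding l by (rule expansion_seq_cong) (auto simp: \<epsilon>'_def c'_def)
    then have "map ((*) e) a @ (2 * d) # l = expansion_seq a (Suc n) \<epsilon>' c'"
      unfolding expansion_seq_Suc[OF n] by (simp add: signed_block_def \<epsilon>'_def c'_def)
    moreover have "\<forall>i\<in>{1..Suc n}. \<epsilon>' i \<in> {1, -1}"
    proof
      fix i assume i: "i \<in> {1..Suc n}"
      show "\<epsilon>' i \<in> {1, -1}"
      proof (cases "i = 1")
        case True
        then show ?thesis using cons_block.hyps(1) by (simp add: \<epsilon>'_def)
      next
        case False
        then have "i - 1 \<in> {1..n}" using i by auto
        then show ?thesis using \<epsilon> False by (simp add: \<epsilon>'_def)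
      qed
    qed
    ultimately show ?case by blast
  qed
next
  assume "\<exists>n \<epsilon> c. n > 0 \<and> (\<forall>i\<in>{1..n}. \<epsilon> i \<in> {1, -1}) \<and> l = expansion_seq a n \<epsilon> c"
  then obtain n \<epsilon> c where "n > 0" "\<forall>i\<in>{1..n}. \<epsilon> i \<in> {1, -1}" "l = expansion_seq a n \<epsilon> c"
    by blast
  then show "expansion_of a l"
  proof (induction n arbitrary: l a \<epsilon> c rule: nat_induct_non_zero)
    case 1
    then show ?case
      using expansion_of.block[of "\<epsilon> 1" a] by (simp add: expansion_seq_def signed_block_def)
  next
    case (Suc n)
    let ?l = "expansion_seq (rev a) n (\<lambda>i. \<epsilon> (Suc i)) (\<lambda>i. c (Suc i))"
    have "expansion_of (rev a) ?l" using Suc.prems(1) by (intro Suc.IH[OF _ refl]) auto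
    moreover have "\<epsilon> 1 \<in> {1, -1}" using Suc.prems(1) by simp
    ultimately have "expansion_of a (map ((*) (\<epsilon> 1)) a @ (2 * c 1) # ?l)"
      by (intro expansion_of.cons_block)
    moreover have "signed_block a \<epsilon> 1 = map ((*) (\<epsilon> 1)) a" by (simp add: signed_block_def)
    ultimately show ?case
      unfolding Suc.prems(2) expansion_seq_Suc[OF Suc.hyps] by simp
  qed
qed

lemma map_times_sign:
  fixes a :: "int list"
  assumes "e \<in> {1, -1}"
  shows "map ((*) e) a = a \<or> map ((*) e) a = map uminus a"
  using assms by (auto intro: map_idI)

lemma map_times_uminus: "map ((*) (- e)) l = map uminus (map ((*) e) l)" for e :: int
  by simp

lemma expansion_of_map_uminus:
  assumes "expansion_of a l"
  shows "expansion_of a (map uminus l)"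
  using assms
proof induction
  case (block e a)
  then have "- e \<in> {1, -1}" by auto
  from expansion_of.block[OF this, of a] show ?case by (simp only: map_times_uminus)
next
  case (cons_block e a l c)
  then have "- e \<in> {1, -1}" by auto
  from expansion_of.cons_block[OF this cons_block.IH, of "- c"] show ?case
    by (simp add: map_times_uminus del: map_map)
qed

definition expansion_values :: "int list \<Rightarrow> complex proj_line set" where
  "expansion_values a = {translation (2 * k) (cfrac_isometry l Infty) | k l. expansion_of a l}"

lemma expansion_values_translation:
  "v \<in> expansion_values a \<Longrightarrow> translation (2 * k) v \<in> expansion_values a"
proof -
  assume "v \<in> expansion_values a"
  then obtain j l where "expansion_of a l" "v = translation (2 * j) (cfrac_isometry l Infty)"
    by (auto simp: expansion_values_def)
  then have "translation (2 * k) v = translation (2 * (k + j)) (cfrac_isometry l Infty)"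
    by (simp add: algebra_simps)
  with \<open>expansion_of a l\<close> show ?thesis unfolding expansion_values_def by blast
qed

lemma expansion_values_axis_reflection:
  assumes "v \<in> expansion_values a"
  shows "axis_reflection v \<in> expansion_values a"
proof -
  obtain j l where l: "expansion_of a l" and v: "v = translation (2 * j) (cfrac_isometry l Infty)"
    using assms by (auto simp: expansion_values_def)
  have "axis_reflection v = translation (2 * (- j)) (cfrac_isometry (map uminus l) Infty)"
    by (simp add: v axis_reflection_translation cfrac_isometry_map_uminus)
  then show ?thesis using expansion_of_map_uminus[OF l] unfolding expansion_values_def by blast
qed

text \<open>Applying \<open>W\<^sub>a\<close> to \<open>A\<^bsup>2k\<^esup> W\<^sub>l \<infinity>\<close> prepends the block \<open>a\<close> and the even entry \<open>2k\<close> to \<open>l\<close>.\<close>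

lemma expansion_values_cfrac_isometry:
  assumes "v \<in> expansion_values (rev a)"
  shows "cfrac_isometry a v \<in> expansion_values a"
proof -
  obtain k l where l: "expansion_of (rev a) l" and v: "v = translation (2 * k) (cfrac_isometry l Infty)"
    using assms by (auto simp: expansion_values_def)
  have "expansion_of a (a @ (2 * k) # l)"
    using expansion_of.cons_block[of 1 a l k] l by (simp add: map_idI)
  moreover have "cfrac_isometry a v = translation (2 * 0) (cfrac_isometry (a @ (2 * k) # l) Infty)"
    by (simp add: v cfrac_isometry_append)
  ultimately show ?thesis unfolding expansion_values_def by blast
qed

text \<open>The previous lemma for \<open>rev a\<close>, because \<open>W\<^sub>a\<^sup>-\<^sup>1\<close> is conjugate by \<open>N\<close> to the isometry of the
  reversed sequence. Both lemmas together give closure under \<open>W\<^sub>a \<Gamma>\<^sub>\<infinity> W\<^sub>a\<^sup>-\<^sup>1\<close>.\<close>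

lemma expansion_values_cfrac_isometry_inverse:
  assumes "v \<in> expansion_values a"
  shows "cfrac_isometry (map uminus (rev a)) v \<in> expansion_values (rev a)"
proof -
  have "cfrac_isometry (rev a) (axis_reflection v) \<in> expansion_values (rev a)"
    using assms by (intro expansion_values_cfrac_isometry) (simp add: expansion_values_axis_reflection)
  then show ?thesis
    unfolding cfrac_isometry_map_uminus by (rule expansion_values_axis_reflection)
qed

lemma cfrac_isometry_Infty_in_expansion_values: "cfrac_isometry a Infty \<in> expansion_values a"
proof -
  have "expansion_of a a" using expansion_of.block[of 1 a] by (simp add: map_idI)
  moreover have "cfrac_isometry a Infty = translation (2 * 0) (cfrac_isometry a Infty)" by simp
  ultimately show ?thesis unfolding expansion_values_def by blast
qed

text \<open>The sequence \<open>(a, 0, - rev a)\<close> has the value \<open>W\<^sub>a W\<^sub>a\<^sup>-\<^sup>1 \<infinity>\<close>.\<close>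

lemma Infty_in_expansion_values: "Infty \<in> expansion_values a"
proof -
  have "cfrac_isometry (map uminus (rev (rev a))) (cfrac_isometry (rev a) Infty) = Infty"
    by (rule cfrac_isometry_inverse)
  then show ?thesis
    using expansion_values_cfrac_isometry_inverse[OF cfrac_isometry_Infty_in_expansion_values, of "rev a"]
    by simp
qed

text \<open>For \<open>P\<close> the union of the two orbits and \<open>Q\<close> its preimage under \<open>W\<^sub>a\<close>, the hypotheses express
  invariance under the two generating groups. They are symmetric under exchange of \<open>(a, P)\<close> and
  \<open>(rev a, Q)\<close>, which makes the induction over expansions work.\<close>

lemma expansion_values_subset:
  assumes "Infty \<in> P" "Infty \<in> Q"
    and trP: "\<And>k v. v \<in> P \<Longrightarrow> translation (2 * k) v \<in> P"
    and trQ: "\<And>k v. v \<in> Q \<Longrightarrow> translation (2 * k) v \<in> Q"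
    and axP: "\<And>v. v \<in> P \<Longrightarrow> axis_reflection v \<in> P"
    and axQ: "\<And>v. v \<in> Q \<Longrightarrow> axis_reflection v \<in> Q"
    and PQ: "\<And>v. v \<in> Q \<Longrightarrow> cfrac_isometry a v \<in> P"
    and QP: "\<And>v. v \<in> P \<Longrightarrow> cfrac_isometry (rev a) v \<in> Q"
  shows "expansion_values a \<subseteq> P"
proof -
  have "cfrac_isometry l Infty \<in> P" if "expansion_of a l" for l
    using that assms
  proof (induction arbitrary: P Q)
    case (block e a)
    have "cfrac_isometry (map uminus a) Infty \<in> P"
      unfolding cfrac_isometry_map_uminus using block.prems by auto
    moreover have "cfrac_isometry a Infty \<in> P" by (intro block.prems)
    ultimately show ?case using map_times_sign[OF block.hyps, of a] by metis
  next
    case (cons_block e a l c)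
    have "cfrac_isometry l Infty \<in> Q"
      using cons_block.prems by (intro cons_block.IH[of Q P]) auto
    then have Q: "translation (2 * c) (cfrac_isometry l Infty) \<in> Q" by (rule cons_block.prems)
    have "cfrac_isometry (map uminus a) (translation (2 * c) (cfrac_isometry l Infty)) \<in> P"
      unfolding cfrac_isometry_map_uminus by (intro cons_block.prems Q)
    moreover have "cfrac_isometry a (translation (2 * c) (cfrac_isometry l Infty)) \<in> P"
      by (intro cons_block.prems Q)
    ultimately show ?case
      unfolding cfrac_isometry_append using map_times_sign[OF cons_block.hyps(1), of a] by metis
  qed
  then show ?thesis using trP by (auto simp: expansion_values_def)
qed

lemma Gamma_hat_orbit_union_eq_expansion_values:
  assumes r: "cfrac a = r"
  shows "Gamma_hat_orbit r r \<union> Gamma_hat_orbit r Infty = expansion_values a" (is "?O = _")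
proof
  let ?W = "cfrac_isometry a" and ?W' = "cfrac_isometry (map uminus (rev a))"
  have r_eq: "ideal_point r = ?W Infty" unfolding r[symmetric] by (rule ideal_point_cfrac)
  have inf_eq: "ideal_point Infty = Infty" by (simp add: ideal_point_def)
  have refl_r: "reflection (?W Infty) (?W (Fin (of_int n))) v = ?W (translation (2 * n) (axis_reflection (?W' v)))"
    for n v
    using reflection_cfrac_isometry[of a n "?W' v"] by (simp add: cfrac_isometry_inverse)
  have "reflection (ideal_point s) q v \<in> expansion_values a"
    if s: "s = r \<or> s = Infty" and edge: "tess_edge (ideal_point s) q" and v: "v \<in> expansion_values a" for s q v
    using s
  proof
    assume "s = Infty"
    then obtain n :: int where "q = Fin (of_int n)" using edge inf_eq tess_edge_Infty_iff by auto
    then show ?thesis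
      using expansion_values_translation[OF expansion_values_axis_reflection[OF v]] \<open>s = Infty\<close>
      by (simp only: inf_eq reflection_Infty_int)
  next
    assume "s = r"
    then obtain n :: int where q: "q = ?W (Fin (of_int n))"
      using edge r_eq tess_edge_cfrac_isometry_iff by auto
    show ?thesis
      unfolding \<open>s = r\<close> q r_eq refl_r
      by (intro expansion_values_cfrac_isometry expansion_values_translation
          expansion_values_axis_reflection expansion_values_cfrac_isometry_inverse v)
  qed
  then have "Gamma_hat_orbit r x \<subseteq> expansion_values a" if "ideal_point x \<in> expansion_values a" for x
    using Gamma_hat_orbit_subset[OF that] by blast
  then show "?O \<subseteq> expansion_values a"
    using cfrac_isometry_Infty_in_expansion_values Infty_in_expansion_values r_eq inf_eq by simp
next
  let ?W = "cfrac_isometry a" and ?W' = "cfrac_isometry (map uminus (rev a))"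
  have r_eq: "ideal_point r = ?W Infty" unfolding r[symmetric] by (rule ideal_point_cfrac)
  have inf_eq: "ideal_point Infty = Infty" by (simp add: ideal_point_def)
  have refl: "reflection Infty (Fin (of_int n)) v \<in> ?O" if "v \<in> ?O" for n :: int and v
    using that Gamma_hat_orbit_reflection[of Infty r "Fin (of_int n)"] tess_edge_Infty_iff
    unfolding inf_eq by blast
  have refl': "?W (translation (2 * n) (axis_reflection w)) \<in> ?O" if "?W w \<in> ?O" for n w
    using that Gamma_hat_orbit_reflection[of r r "?W (Fin (of_int n))"] tess_edge_cfrac_isometry_iff
    unfolding r_eq reflection_cfrac_isometry[symmetric] by blast
  have ax: "axis_reflection v \<in> ?O" if "v \<in> ?O" for v
    using refl[OF that, of 0] by (simp only: reflection_Infty_int) simp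
  have ax': "?W (axis_reflection w) \<in> ?O" if "?W w \<in> ?O" for w
    using refl'[OF that, of 0] by simp
  have "Infty \<in> ?O" "?W Infty \<in> ?O"
    using Gamma_hat_orbit_self[of Infty r] Gamma_hat_orbit_self[of r r] r_eq inf_eq by auto
  show "expansion_values a \<subseteq> ?O"
  \<comment> \<open>\<open>Q\<close> is the preimage of the orbits under \<open>W\<^sub>a\<close>; it is invariant under \<open>\<Gamma>\<^sub>\<infinity>\<close> because the orbits
    are invariant under \<open>\<Gamma>\<^sub>r\<close>.\<close>
  proof (rule expansion_values_subset[where Q = "{w. ?W w \<in> ?O}"])
    show "translation (2 * k) v \<in> ?O" if "v \<in> ?O" for k v
      using refl[OF ax[OF that], of k] by (simp only: reflection_Infty_int) simp
    show "translation (2 * k) w \<in> {w. ?W w \<in> ?O}" if "w \<in> {w. ?W w \<in> ?O}" for k w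
      using refl'[OF ax', of w k] that by simp
    show "cfrac_isometry (rev a) v \<in> {w. ?W w \<in> ?O}" if "v \<in> ?O" for v
    proof -
      have "cfrac_isometry (rev a) v = axis_reflection (?W' (axis_reflection v))"
        by (simp add: cfrac_isometry_map_uminus)
      moreover have "?W (?W' (axis_reflection v)) \<in> ?O"
        using ax[OF that] by (simp only: cfrac_isometry_inverse)
      ultimately show ?thesis using ax' by simp
    qed
  qed (use \<open>Infty \<in> ?O\<close> \<open>?W Infty \<in> ?O\<close> ax ax' in auto)
qed

lemma ideal_point_proj_add_int: "ideal_point (proj_add_int k x) = translation k (ideal_point x)"
  by (cases x) (simp_all add: ideal_point_def proj_add_int_def of_rat_add)

lemma inj_ideal_point: "inj ideal_point"
  unfolding ideal_point_def by (rule proj_line.inj_map) (simp add: inj_def)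

theorem proposition5p1:
  fixes a :: "int list" and r r' :: rat
  assumes "a \<noteq> []" and "cfrac a = Fin r"
  shows "ideal_point (Fin r') \<in> Gamma_hat_orbit (Fin r) (Fin r) \<union> Gamma_hat_orbit (Fin r) Infty
    \<longleftrightarrow> (\<exists>(n::nat) (k::int) (\<epsilon> :: nat \<Rightarrow> int) (c :: nat \<Rightarrow> int).
           n > 0 \<and> (\<forall>i\<in>{1..n}. \<epsilon> i \<in> {1, -1}) \<and>
           Fin r' = proj_add_int (2 * k) (cfrac (expansion_seq a n \<epsilon> c)))"
proof -
  have "translation (2 * k) (cfrac_isometry l Infty) = ideal_point (proj_add_int (2 * k) (cfrac l))" for k l
    by (simp add: ideal_point_proj_add_int ideal_point_cfrac)
  then have "ideal_point (Fin r') \<in> expansion_values a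
      \<longleftrightarrow> (\<exists>k. \<exists>l. expansion_of a l \<and> Fin r' = proj_add_int (2 * k) (cfrac l))"
    using inj_eq[OF inj_ideal_point] by (auto simp: expansion_values_def)
  then show ?thesis
    unfolding Gamma_hat_orbit_union_eq_expansion_values[OF assms(2)] expansion_of_iff by blast
qed

end
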